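(* Let $(X,\mathsf a)$ be an action space. For every $u\in\mathrm{AC}_{\mathsf a}([a,b];X)$ we have $\mathbb A(u;[a,b])<\infty$ and $$\mathbb A(u;[a,b])=\int_a^b\mathfrak a[u'](t)\,\mathrm dt .$$
   Context: An action cost on a set $X$ is a function $\mathsf a:(0,+\infty)\times X\times X\to[0,+\infty)$ such that for all $\tau,\tau_1,\tau_2>0$ and $u_1,u_2,u_3\in X$: (i) $\mathsf a(\tau,u_1,u_2)=0$ if and only if $u_1=u_2$; (ii) $\mathsf a(\tau,u_1,u_2)=\mathsf a(\tau,u_2,u_1)$; (iii) $\mathsf a(\tau_1+\tau_2,u_1,u_3)\le \mathsf a(\tau_1,u_1,u_2)+\mathsf a(\tau_2,u_2,u_3)$. The pair $(X,\mathsf a)$ is called an action space. The $\mathsf a$-action of a curve $u:[a,b]\to X$ is $\mathbb A(u;[a,b]):=\sup\sum_{j=1}^M\mathsf a(t^j-t^{j-1},u(t^{j-1}),u(t^j))$, the supremum being over all finite partitions $a=t^0<t^1<\dots<t^M=b$. A curve $u:[a,b]\to X$ is $\mathsf a$-absolutely continuous, $u\in\mathrm{AC}_{\mathsf a}([a,b];X)$, if there exists $g\in L^1(a,b)$ such that $\mathsf a(t-s,u(s),u(t))\le\int_s^tg(r)\,\mathrm dr$ for all $a\le s<t\le b$. For such $u$ the action density is $\mathfrak a[u'](t):=\lim_{\sigma\downarrow t}\frac{\mathsf a(\sigma-t,u(t),u(\sigma))}{\sigma-t}=\lim_{\sigma\uparrow t}\frac{\mathsf a(t-\sigma,u(\sigma),u(t))}{t-\sigma}$,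 which exists for a.e. $t\in(a,b)$ and belongs to $L^1(a,b)$. *)

theory Defs
  imports "HOL-Analysis.Analysis"
begin

text \<open>The cost is a total function in HOL; only its values at positive times and at points
  of \<open>X\<close> are constrained.\<close>

locale action_space =
  fixes X :: "'a set" and c :: "real \<Rightarrow> 'a \<Rightarrow> 'a \<Rightarrow> real"
  assumes cost_nonneg: "\<lbrakk>\<tau> > 0; x \<in> X; y \<in> X\<rbrakk> \<Longrightarrow> 0 \<le> c \<tau> x y"
    and cost_eq_0_iff: "\<lbrakk>\<tau> > 0; x \<in> X; y \<in> X\<rbrakk> \<Longrightarrow> c \<tau> x y = 0 \<longleftrightarrow> x = y"
    and cost_sym: "\<lbrakk>\<tau> > 0; x \<in> X; y \<in> X\<rbrakk> \<Longrightarrow> c \<tau> x y = c \<tau> y x"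
    and cost_triangle: "\<lbrakk>\<tau>\<^sub>1 > 0; \<tau>\<^sub>2 > 0; x \<in> X; y \<in> X; z \<in> X\<rbrakk>
      \<Longrightarrow> c (\<tau>\<^sub>1 + \<tau>\<^sub>2) x z \<le> c \<tau>\<^sub>1 x y + c \<tau>\<^sub>2 y z"

text \<open>A partition is a pair \<open>(M, t)\<close>; the values \<open>t j\<close> for \<open>j > M\<close> are irrelevant.\<close>

definition partitions :: "real \<Rightarrow> real \<Rightarrow> (nat \<times> (nat \<Rightarrow> real)) set" where
  "partitions a b = {(M, t). t 0 = a \<and> t M = b \<and> strict_mono_on {0..M} t}"

definition curve_action ::
    "(real \<Rightarrow> 'a \<Rightarrow> 'a \<Rightarrow> real) \<Rightarrow> (real \<Rightarrow> 'a) \<Rightarrow> real \<Rightarrow> real \<Rightarrow> ereal" where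
  "curve_action c u a b =
    (SUP (M, t) \<in> partitions a b.
      ereal (\<Sum>j=1..M. c (t j - t (j - 1)) (u (t (j - 1))) (u (t j))))"

text \<open>The measure is \<open>lebesgue\<close> rather than \<open>lborel\<close>, so that functions agreeing almost
  everywhere with a measurable function are measurable.\<close>

definition AC_curves ::
    "'a set \<Rightarrow> (real \<Rightarrow> 'a \<Rightarrow> 'a \<Rightarrow> real) \<Rightarrow> real \<Rightarrow> real \<Rightarrow> (real \<Rightarrow> 'a) set" where
  "AC_curves X c a b = {u \<in> {a..b} \<rightarrow> X.
    \<exists>g :: real \<Rightarrow> real. set_integrable lebesgue {a<..<b} g \<and>
      (\<forall>s t. a \<le> s \<and> s < t \<and> t \<le> b \<longrightarrow>
        c (t - s) (u s) (u t) \<le> (LINT r:{s<..<t}|lebesgue. g r))}"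

definition has_action_density ::
    "(real \<Rightarrow> 'a \<Rightarrow> 'a \<Rightarrow> real) \<Rightarrow> (real \<Rightarrow> 'a) \<Rightarrow> real \<Rightarrow> real \<Rightarrow> bool" where
  "has_action_density c u t l \<longleftrightarrow>
    ((\<lambda>\<sigma>. c (\<sigma> - t) (u t) (u \<sigma>) / (\<sigma> - t)) \<longlongrightarrow> l) (at_right t) \<and>
    ((\<lambda>\<sigma>. c (t - \<sigma>) (u \<sigma>) (u t) / (t - \<sigma>)) \<longlongrightarrow> l) (at_left t)"

text \<open>Unspecified at those \<open>t\<close> where the one-sided limits do not exist or differ.\<close>

definition action_density ::
    "(real \<Rightarrow> 'a \<Rightarrow> 'a \<Rightarrow> real) \<Rightarrow> (real \<Rightarrow> 'a) \<Rightarrow> real \<Rightarrow> real" where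
  "action_density c u t = (THE l. has_action_density c u t l)"

end

theory Submission
  imports Defs
begin

text \<open>
  For \<open>s < t\<close> write \<open>f s t\<close> for the cost of moving from \<open>u s\<close> to \<open>u t\<close> in time
  \<open>t - s\<close>. Then \<open>f\<close> is nonnegative, subadditive under concatenation of intervals, and
  bounded by the integral of an integrable function \<open>g\<close>. The action of \<open>u\<close> is the variation of \<open>f\<close>, the supremum of its sums over partitions.

  The variation over \<open>[a, t]\<close> is a function \<open>F\<close> of \<open>t\<close> with
  \<open>f s t \<le> F t - F s \<le> \<integral>\<^sub>s\<^sup>t \<bar>g\<bar>\<close> (lemmas \<open>increment_ge_f\<close> and
  \<open>increment_le_G\<close>). By the upper bound and the Radon-Nikodym theorem \<open>F\<close> is the primitive of
  an integrable \<open>h\<close> (\<open>density_of_dominated_increments\<close>), so the action of \<open>u\<close> is the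
  integral of \<open>h\<close>, and it remains to see that the action density exists and equals \<open>h\<close>
  almost everywhere.

  The defect \<open>e s t = \<integral>\<^sub>s\<^sup>t h - f s t\<close> is nonnegative and superadditive, and its sum over a
  suitable partition is as small as desired, because the partition sums of \<open>f\<close> approximate the
  integral of \<open>h\<close>. The exceptional points, near which \<open>f\<close> differs from \<open>(t - s) h\<close> by at
  least \<open>\<epsilon> (t - s)\<close> on arbitrarily short intervals, are covered in the sense of Vitali by such
  intervals. On disjoint intervals of the cover lying inside the cells of the partition the defect is
  small in total by superadditivity, and the deviation of \<open>\<integral>\<^sub>s\<^sup>t h\<close> from \<open>(t - s) h\<close> is
  small in total by Henstock's lemma; hence the exceptional set is negligible
  (\<open>negligible_relative_error_ge\<close>). This treats the differentiation of \<open>F\<close> and the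
  comparison of \<open>f\<close> with \<open>F\<close> in a single covering argument.
\<close>

section \<open>Partitions\<close>

definition partition_sum :: "(real \<Rightarrow> real \<Rightarrow> real) \<Rightarrow> nat \<Rightarrow> (nat \<Rightarrow> real) \<Rightarrow> real" where
  "partition_sum f M t = (\<Sum>j=1..M. f (t (j - 1)) (t j))"

definition variation :: "(real \<Rightarrow> real \<Rightarrow> real) \<Rightarrow> real \<Rightarrow> real \<Rightarrow> real" where
  "variation f a b = (SUP (M, t) \<in> partitions a b. partition_sum f M t)"

lemma partition_sum_0 [simp]: "partition_sum f 0 t = 0"
  by (simp add: partition_sum_def)

lemma partition_sum_Suc [simp]:
  "partition_sum f (Suc M) t = partition_sum f M t + f (t M) (t (Suc M))"
  by (simp add: partition_sum_def)

lemma partition_sum_cong: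
  "(\<And>j. j \<le> M \<Longrightarrow> t j = t' j) \<Longrightarrow> partition_sum f M t = partition_sum f M t'"
  unfolding partition_sum_def by (intro sum.cong) auto

lemma partitions_0_iff: "(0, t) \<in> partitions a b \<longleftrightarrow> t 0 = a \<and> a = b"
  by (auto simp: partitions_def strict_mono_on_def)

lemma partitions_Suc_iff:
  "(Suc M, t) \<in> partitions a b \<longleftrightarrow> (M, t) \<in> partitions a (t M) \<and> t M < b \<and> t (Suc M) = b"
proof -
  have "strict_mono_on {0..Suc M} t \<longleftrightarrow> strict_mono_on {0..M} t \<and> t M < t (Suc M)"
  proof
    assume "strict_mono_on {0..M} t \<and> t M < t (Suc M)"
    then have less: "t i < t j" if "i < j" "j \<le> M" for i j
      using that by (auto simp: strict_mono_on_def)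
    then have "t i < t (Suc M)" if "i \<le> M" for i
      using that less[of i M] \<open>_ \<and> t M < t (Suc M)\<close> by (metis le_neq_implies_less less_trans order_refl)
    with less show "strict_mono_on {0..Suc M} t"
      by (auto simp: strict_mono_on_def le_Suc_eq)
  qed (auto simp: strict_mono_on_def)
  then show ?thesis by (auto simp: partitions_def)
qed

lemma partitions_bounds:
  "(M, t) \<in> partitions a b \<Longrightarrow> a \<le> b \<and> (\<forall>j\<le>M. a \<le> t j \<and> t j \<le> b)"
proof (induction M arbitrary: b)
  case (Suc M)
  then show ?case
    using Suc.IH[of "t M"] by (force simp: partitions_Suc_iff le_Suc_eq)
qed (auto simp: partitions_0_iff)

lemma partitions_extend:
  assumes "(M, t) \<in> partitions a s" "s < r"
  shows "(Suc M, t(Suc M := r)) \<in> partitions a r"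
    and "partition_sum f (Suc M) (t(Suc M := r)) = partition_sum f M t + f s r"
proof -
  have [simp]: "t M = s" using assms by (simp add: partitions_def)
  have "strict_mono_on {0..M} (t(Suc M := r)) \<longleftrightarrow> strict_mono_on {0..M} t"
    by (auto simp: strict_mono_on_def)
  with assms show "(Suc M, t(Suc M := r)) \<in> partitions a r"
    by (simp add: partitions_Suc_iff) (simp add: partitions_def)
  show "partition_sum f (Suc M) (t(Suc M := r)) = partition_sum f M t + f s r"
    by (simp add: partition_sum_cong[of M "t(Suc M := r)" t])
qed

lemma partitions_nonempty:
  assumes "a \<le> b" shows "partitions a b \<noteq> {}"
proof (cases "a = b")
  case True
  then have "(0, \<lambda>_. a) \<in> partitions a b" by (simp add: partitions_0_iff)
  then show ?thesis by blast
next
  case False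
  have "(0, \<lambda>_. a) \<in> partitions a a" by (simp add: partitions_0_iff)
  from partitions_extend(1)[OF this] show ?thesis using False assms by force
qed

section \<open>Variation of a subadditive interval function\<close>

text \<open>The diagonal has to vanish so that degenerate intervals may occur in the inequalities below;
  for an action cost, which has no value at time \<open>0\<close>, this is a convention.\<close>

locale subadditive_interval =
  fixes f :: "real \<Rightarrow> real \<Rightarrow> real" and a b :: real
  assumes nonneg: "\<lbrakk>a \<le> s; s \<le> t; t \<le> b\<rbrakk> \<Longrightarrow> 0 \<le> f s t"
    and diag: "f s s = 0"
    and subadd: "\<lbrakk>a \<le> r; r \<le> s; s \<le> t; t \<le> b\<rbrakk> \<Longrightarrow> f r t \<le> f r s + f s t"

locale dominated_interval = subadditive_interval +
  fixes G :: "real \<Rightarrow> real"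
  assumes le_G: "\<lbrakk>a \<le> s; s \<le> t; t \<le> b\<rbrakk> \<Longrightarrow> f s t \<le> G t - G s"
begin

lemma partition_sum_le:
  "(M, t) \<in> partitions a s \<Longrightarrow> s \<le> b \<Longrightarrow> partition_sum f M t \<le> G s - G a"
proof (induction M arbitrary: s)
  case (Suc M)
  then have *: "(M, t) \<in> partitions a (t M)" "t M < s" "t (Suc M) = s"
    by (auto simp: partitions_Suc_iff)
  then have "partition_sum f M t \<le> G (t M) - G a" using Suc by auto
  moreover have "f (t M) s \<le> G s - G (t M)"
    using * partitions_bounds[OF *(1)] Suc.prems by (intro le_G) auto
  ultimately show ?case using * by simp
qed (auto simp: partitions_0_iff)

lemma bdd_above_partition_sums:
  "s \<le> b \<Longrightarrow> bdd_above ((\<lambda>(M, t). partition_sum f M t) ` partitions a s)"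
  using partition_sum_le by (intro bdd_aboveI2[of _ _ "G s - G a"]) auto

lemma partition_sum_le_variation:
  "(M, t) \<in> partitions a s \<Longrightarrow> s \<le> b \<Longrightarrow> partition_sum f M t \<le> variation f a s"
  unfolding variation_def using cSUP_upper[OF _ bdd_above_partition_sums] by force

lemma variation_least:
  assumes "a \<le> s" "\<And>M t. (M, t) \<in> partitions a s \<Longrightarrow> partition_sum f M t \<le> B"
  shows "variation f a s \<le> B"
  unfolding variation_def using assms partitions_nonempty by (intro cSUP_least) auto

lemma increment_ge_f:
  assumes "a \<le> s" "s \<le> r" "r \<le> b"
  shows "f s r \<le> variation f a r - variation f a s"
proof (cases "s = r")
  case False
  have "variation f a s \<le> variation f a r - f s r"
  proof (rule variation_least)
    fix M t assume "(M, t) \<in> partitions a s"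
    from partitions_extend[OF this, of r] False assms partition_sum_le_variation
    show "partition_sum f M t \<le> variation f a r - f s r" by fastforce
  qed (use assms in auto)
  then show ?thesis by simp
qed (simp add: diag)

text \<open>Adding the point \<open>s\<close> to the partition increases the sum by subadditivity, and the intervals to
  the right of \<open>s\<close> then contribute at most \<open>G r - G s\<close>. This gives the upper bound on the
  increments of the variation.\<close>

lemma partition_truncate:
  "\<lbrakk>(M, t) \<in> partitions a r; a \<le> s; s \<le> r; r \<le> b\<rbrakk>
    \<Longrightarrow> \<exists>N t'. (N, t') \<in> partitions a s \<and> partition_sum f M t \<le> partition_sum f N t' + (G r - G s)"
proof (induction M arbitrary: r)
  case 0
  then have "s = r" by (auto simp: partitions_0_iff)
  with 0 show ?case by (intro exI[of _ 0] exI[of _ t]) auto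
next
  case (Suc M)
  then have *: "(M, t) \<in> partitions a (t M)" "t M < r" "t (Suc M) = r"
    by (auto simp: partitions_Suc_iff)
  have aM: "a \<le> t M" using partitions_bounds[OF *(1)] by auto
  show ?case
  proof (cases "s \<le> t M")
    case True
    obtain N t' where "(N, t') \<in> partitions a s"
        "partition_sum f M t \<le> partition_sum f N t' + (G (t M) - G s)"
      using Suc.IH[OF *(1)] True Suc.prems * by auto
    moreover have "f (t M) r \<le> G r - G (t M)" using * aM Suc.prems by (intro le_G) auto
    ultimately show ?thesis using * by (intro exI[of _ N] exI[of _ t']) auto
  next
    case False
    have "f (t M) r \<le> f (t M) s + f s r" using * aM Suc.prems False by (intro subadd) auto
    moreover have "f s r \<le> G r - G s" using Suc.prems by (intro le_G) auto
    ultimately show ?thesis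
      using partitions_extend(1)[OF *(1), of s] partitions_extend(2)[OF *(1), of s f] False *(3)
      by (intro exI[of _ "Suc M"] exI[of _ "t(Suc M := s)"] conjI)
        (simp_all del: fun_upd_apply partition_sum_Suc add: partition_sum_Suc[of f M t])
  qed
qed

lemma increment_le_G:
  assumes "a \<le> s" "s \<le> r" "r \<le> b"
  shows "variation f a r - variation f a s \<le> G r - G s"
proof -
  have "variation f a r \<le> variation f a s + (G r - G s)"
  proof (rule variation_least)
    fix M t assume "(M, t) \<in> partitions a r"
    from partition_truncate[OF this assms] partition_sum_le_variation assms
    show "partition_sum f M t \<le> variation f a s + (G r - G s)" by fastforce
  qed (use assms in auto)
  then show ?thesis by simp
qed

lemma variation_refl: "a \<le> b \<Longrightarrow> variation f a a = 0"
proof -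
  assume ab: "a \<le> b"
  have M: "M = 0" if "(M, t) \<in> partitions a a" for M t
    using that partitions_bounds[of "M-1" t a "t (M-1)"] by (cases M) (auto simp: partitions_Suc_iff)
  have "variation f a a \<le> 0" by (rule variation_least) (auto dest: M)
  moreover have "(0, \<lambda>_. a) \<in> partitions a a" by (simp add: partitions_0_iff)
  then have "0 \<le> variation f a a" using partition_sum_le_variation[of 0 "\<lambda>_. a" a] ab by auto
  ultimately show ?thesis by simp
qed

end

section \<open>Superadditive interval functions and Vitali covers\<close>

definition superadditive_on :: "real \<Rightarrow> real \<Rightarrow> (real \<Rightarrow> real \<Rightarrow> real) \<Rightarrow> bool" where
  "superadditive_on p q e \<longleftrightarrow>
    (\<forall>s t. p \<le> s \<and> s \<le> t \<and> t \<le> q \<longrightarrow> 0 \<le> e s t) \<and>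
    (\<forall>r s t. p \<le> r \<and> r \<le> s \<and> s \<le> t \<and> t \<le> q \<longrightarrow> e r s + e s t \<le> e r t)"

lemma superadditive_on_subset:
  "superadditive_on p q e \<Longrightarrow> p \<le> p' \<Longrightarrow> q' \<le> q \<Longrightarrow> superadditive_on p' q' e"
  unfolding superadditive_on_def by (meson order_trans)

text \<open>Remove the rightmost interval: the others lie to the left of it, and superadditivity absorbs
  the gaps because \<open>e\<close> is nonnegative.\<close>

lemma superadditive_sum_disjoint:
  fixes l r :: "'i \<Rightarrow> real"
  assumes "finite C" "superadditive_on p q e" "p \<le> q"
    and "\<And>i. i \<in> C \<Longrightarrow> p \<le> l i \<and> l i < r i \<and> r i \<le> q"
    and "pairwise (\<lambda>i j. disjnt {l i..r i} {l j..r j}) C"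
  shows "(\<Sum>i\<in>C. e (l i) (r i)) \<le> e p q"
  using assms
proof (induction "card C" arbitrary: C q)
  case 0
  then show ?case by (auto simp: superadditive_on_def)
next
  case (Suc n)
  have "C \<noteq> {}" using Suc.hyps by auto
  then obtain i where i: "i \<in> C" "\<And>j. j \<in> C \<Longrightarrow> l j \<le> l i"
    using \<open>finite C\<close> Max_in[of "l ` C"] Max_ge[of "l ` C"] by (metis (no_types, lifting) finite_imageI image_iff image_is_empty)
  have left: "r j \<le> l i" if "j \<in> C - {i}" for j
  proof (rule ccontr)
    assume "\<not> r j \<le> l i"
    then have "l i \<in> {l i..r i} \<inter> {l j..r j}" using i Suc.prems(4)[of i] that by auto
    moreover have "disjnt {l i..r i} {l j..r j}"
      using Suc.prems(5) i(1) that by (auto simp: pairwise_def)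
    ultimately show False by (auto simp: disjnt_def)
  qed
  have b: "p \<le> l i" "l i < r i" "r i \<le> q" using Suc.prems(4)[OF i(1)] by auto
  have "(\<Sum>j\<in>C - {i}. e (l j) (r j)) \<le> e p (l i)"
  proof (rule Suc.hyps(1))
    show "n = card (C - {i})" using Suc.hyps(2) i(1) \<open>finite C\<close> by simp
    show "superadditive_on p (l i) e"
      using superadditive_on_subset[OF Suc.prems(2)] b by simp
    show "p \<le> l j \<and> l j < r j \<and> r j \<le> l i" if "j \<in> C - {i}" for j
      using Suc.prems(4)[of j] left[OF that] that by auto
    show "pairwise (\<lambda>i j. disjnt {l i..r i} {l j..r j}) (C - {i})"
      using Suc.prems(5) by (rule pairwise_subset) auto
  qed (use Suc.prems b in auto)
  moreover have "e p (l i) + e (l i) (r i) \<le> e p (r i)" "e p (r i) + e (r i) q \<le> e p q" "0 \<le> e (r i) q"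
    using Suc.prems(2) b unfolding superadditive_on_def by auto
  ultimately show ?case
    using sum.remove[OF \<open>finite C\<close> i(1), of "\<lambda>j. e (l j) (r j)"] by simp
qed

text \<open>Intervals that contain no partition point sit inside the cells, so even their total is
  controlled by the partition sum, which can be far smaller than \<open>e p q\<close>.\<close>

lemma superadditive_sum_disjoint_partition:
  fixes l r :: "'i \<Rightarrow> real"
  assumes "(M, t) \<in> partitions p q" "superadditive_on p q e" "finite C"
    and "\<And>i. i \<in> C \<Longrightarrow> p \<le> l i \<and> l i < r i \<and> r i \<le> q"
    and "\<And>i j. i \<in> C \<Longrightarrow> j \<le> M \<Longrightarrow> t j \<notin> {l i..r i}"
    and "pairwise (\<lambda>i j. disjnt {l i..r i} {l j..r j}) C"
  shows "(\<Sum>i\<in>C. e (l i) (r i)) \<le> partition_sum e M t"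
  using assms
proof (induction M arbitrary: C q)
  case 0
  then have "C = {}" by (fastforce simp: partitions_0_iff)
  then show ?case by simp
next
  case (Suc M)
  then have *: "(M, t) \<in> partitions p (t M)" "t M < q" "t (Suc M) = q"
    by (auto simp: partitions_Suc_iff)
  have pM: "p \<le> t M" using partitions_bounds[OF *(1)] by auto
  let ?L = "{i\<in>C. r i < t M}" and ?R = "{i\<in>C. t M < l i}"
  have C: "?L \<union> ?R = C" using Suc.prems(5)[of _ M] by (force simp: not_less)
  have "(\<Sum>i\<in>?L. e (l i) (r i)) \<le> partition_sum e M t"
  proof (rule Suc.IH[OF *(1)])
    show "superadditive_on p (t M) e" using superadditive_on_subset[OF Suc.prems(2)] * by simp
    show "pairwise (\<lambda>i j. disjnt {l i..r i} {l j..r j}) ?L"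
      using Suc.prems(6) by (rule pairwise_subset) auto
    show "t j \<notin> {l i..r i}" if "i \<in> ?L" "j \<le> M" for i j
      using Suc.prems(5)[of i j] that by simp
  qed (use Suc.prems in auto)
  moreover have "(\<Sum>i\<in>?R. e (l i) (r i)) \<le> e (t M) q"
  proof (rule superadditive_sum_disjoint[where l = l and r = r])
    show "superadditive_on (t M) q e" using superadditive_on_subset[OF Suc.prems(2)] pM by simp
    show "pairwise (\<lambda>i j. disjnt {l i..r i} {l j..r j}) ?R"
      using Suc.prems(6) by (rule pairwise_subset) auto
  qed (use Suc.prems * in auto)
  moreover have "(\<Sum>i\<in>C. e (l i) (r i)) = (\<Sum>i\<in>?L. e (l i) (r i)) + (\<Sum>i\<in>?R. e (l i) (r i))"
  proof -
    have "?L \<inter> ?R = {}" using Suc.prems(4) by fastforce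
    then have "(\<Sum>i\<in>?L \<union> ?R. e (l i) (r i)) = (\<Sum>i\<in>?L. e (l i) (r i)) + (\<Sum>i\<in>?R. e (l i) (r i))"
      using Suc.prems(3) by (intro sum.union_disjoint) auto
    then show ?thesis using C by simp
  qed
  ultimately show ?case using * by simp
qed

text \<open>The form in which Vitali's covering theorem is used: a bound on the total length of finite
  disjoint subfamilies of a fine cover is a bound on the outer measure of the covered set. The
  first component \<open>x\<close> of a triple records the point for which the interval \<open>[s, t]\<close> was
  chosen; it may be an endpoint.\<close>

lemma vitali_intervals:
  fixes K :: "(real \<times> real \<times> real) set"
  assumes len: "\<And>x s t. (x, s, t) \<in> K \<Longrightarrow> s < t \<and> s \<le> x \<and> x \<le> t"
    and fine: "\<And>x d. x \<in> E \<Longrightarrow> 0 < d \<Longrightarrow> \<exists>s t. (x, s, t) \<in> K \<and> t - s < d"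
    and bound: "\<And>C. \<lbrakk>C \<subseteq> K; finite C; pairwise (\<lambda>(x, s, t) (x', s', t'). disjnt {s..t} {s'..t'}) C\<rbrakk>
      \<Longrightarrow> (\<Sum>(x, s, t)\<in>C. t - s) \<le> B"
  obtains T where "E \<subseteq> T" "T \<in> lmeasurable" "measure lebesgue T \<le> B"
proof -
  define mid rad where "mid = (\<lambda>(x::real, s::real, t::real). (s + t) / 2)"
    and "rad = (\<lambda>(x::real, s::real, t::real). (t - s) / 2)"
  have cb: "cball (mid (x, s, t)) (rad (x, s, t)) = {s..t}" for x s t
    by (simp add: mid_def rad_def cball_eq_atLeastAtMost field_simps)
  obtain C where C: "countable C" "C \<subseteq> K"
     "pairwise (\<lambda>i j. disjnt (cball (mid i) (rad i)) (cball (mid j) (rad j))) C"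
     "negligible (E - (\<Union>i \<in> C. cball (mid i) (rad i)))"
  proof (rule Vitali_covering_theorem_cballs[of K rad E mid])
    show "0 < rad i" if "i \<in> K" for i using len that by (cases i) (auto simp: rad_def)
    show "\<exists>i. i \<in> K \<and> x \<in> cball (mid i) (rad i) \<and> rad i < d" if xd: "x \<in> E" "0 < d" for x d
    proof -
      obtain s t where st: "(x, s, t) \<in> K" "t - s < d" using fine[OF xd] by blast
      with len[OF st(1)] show ?thesis
        by (intro exI[of _ "(x, s, t)"]) (auto simp: cb, auto simp: rad_def)
    qed
  qed blast
  define U where "U = (\<Union>i \<in> C. cball (mid i) (rad i))"
  have fin: "measure lebesgue (\<Union>i\<in>C'. cball (mid i) (rad i)) \<le> B" if C': "C' \<subseteq> C" "finite C'" for C'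
  proof -
    have pw: "pairwise (\<lambda>(x, s, t) (x', s', t'). disjnt {s..t} {s'..t'}) C'"
      using pairwise_subset[OF C(3) C'(1)] unfolding pairwise_def case_prod_unfold by (metis cb prod.collapse)
    have "measure lebesgue (\<Union>i\<in>C'. cball (mid i) (rad i)) \<le> (\<Sum>i\<in>C'. measure lebesgue (cball (mid i) (rad i)))"
      using C'(2) by (intro measure_UNION_le) auto
    also have "\<dots> = (\<Sum>(x, s, t)\<in>C'. t - s)"
    proof (rule sum.cong)
      fix i assume "i \<in> C'"
      then show "measure lebesgue (cball (mid i) (rad i)) = (case i of (x, s, t) \<Rightarrow> t - s)"
        using len C' C(2) by (cases i) (fastforce simp: cb)
    qed simp
    also have "\<dots> \<le> B" by (rule bound) (use C C' pw in auto)
    finally show ?thesis .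
  qed
  have U: "U \<in> lmeasurable" "measure lebesgue U \<le> B"
    unfolding U_def
    by (rule fmeasurable_UN_bound[OF C(1) lmeasurable_cball fin] measure_UN_bound[OF C(1) lmeasurable_cball fin]; assumption)+
  have neg: "negligible (E - U)" using C(4) by (simp add: U_def)
  show thesis
  proof (rule that)
    show "E \<subseteq> U \<union> (E - U)" by blast
    show "U \<union> (E - U) \<in> lmeasurable" by (rule fmeasurable.Un[OF U(1) negligible_imp_measurable[OF neg]])
    have "measure lebesgue (U \<union> (E - U)) \<le> measure lebesgue U + measure lebesgue (E - U)"
      using U neg by (intro measure_Un_le) (auto simp: negligible_imp_sets)
    then show "measure lebesgue (U \<union> (E - U)) \<le> B" using U neg by (simp add: negligible_imp_measure0)
  qed
qed

section \<open>Intervals with large relative error\<close>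

lemma partition_sum_defect:
  assumes "h integrable_on {a..b}" "(M, t) \<in> partitions a r" "r \<le> b"
  shows "partition_sum (\<lambda>s t. integral {s..t} h - f s t) M t = integral {a..r} h - partition_sum f M t"
  using assms(2,3)
proof (induction M arbitrary: r)
  case 0
  then show ?case by (auto simp: partitions_0_iff)
next
  case (Suc M)
  then have *: "(M, t) \<in> partitions a (t M)" "t M < r" "t (Suc M) = r"
    by (auto simp: partitions_Suc_iff)
  have aM: "a \<le> t M" using partitions_bounds[OF *(1)] by auto
  have "h integrable_on {a..r}"
    using assms(1) by (rule integrable_on_subinterval) (use Suc.prems in auto)
  then have "integral {a..t M} h + integral {t M..r} h = integral {a..r} h"
    using aM * by (intro Henstock_Kurzweil_Integration.integral_combine) auto
  then show ?case using Suc.IH[OF *(1)] * Suc.prems by simp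
qed

context subadditive_interval
begin

lemma superadditive_defect:
  assumes h: "h integrable_on {a..b}"
    and le: "\<And>s t. \<lbrakk>a \<le> s; s \<le> t; t \<le> b\<rbrakk> \<Longrightarrow> f s t \<le> integral {s..t} h"
  shows "superadditive_on a b (\<lambda>s t. integral {s..t} h - f s t)"
  unfolding superadditive_on_def
proof (intro conjI allI impI)
  fix r s t assume *: "a \<le> r \<and> r \<le> s \<and> s \<le> t \<and> t \<le> b"
  have "h integrable_on {r..t}"
    using h by (rule integrable_on_subinterval) (use * in auto)
  then have "integral {r..s} h + integral {s..t} h = integral {r..t} h"
    using * by (intro Henstock_Kurzweil_Integration.integral_combine) auto
  with subadd[of r s t] *
  show "integral {r..s} h - f r s + (integral {s..t} h - f s t) \<le> integral {r..t} h - f r t"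
    by auto
qed (use le in auto)

text \<open>Cover the exceptional points \<open>x\<close> by short intervals on which the error is at least
  \<open>\<epsilon>\<close> times the length. The error \<open>f s t - (t - s) * h x\<close> splits into the defect
  \<open>integral {s..t} h - f s t\<close> and \<open>integral {s..t} h - (t - s) * h x\<close>. Over disjoint
  intervals avoiding the points of a nearly optimal partition the defects sum to at most \<open>\<eta>\<close>
  by superadditivity; over disjoint intervals fine for a suitable gauge the other terms sum to less
  than \<open>\<eta>\<close> by Henstock's lemma. So the covering intervals have total length at most
  \<open>2 * \<eta> / \<epsilon>\<close>, and \<open>\<eta>\<close> is arbitrary.\<close>

lemma negligible_relative_error_ge:
  assumes h: "h integrable_on {a..b}"
    and le: "\<And>s t. \<lbrakk>a \<le> s; s \<le> t; t \<le> b\<rbrakk> \<Longrightarrow> f s t \<le> integral {s..t} h"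
    and approx: "\<And>\<eta>. \<eta> > 0 \<Longrightarrow>
      \<exists>M t. (M, t) \<in> partitions a b \<and> integral {a..b} h - \<eta> \<le> partition_sum f M t"
    and "\<epsilon> > 0"
  shows "negligible {x. \<forall>d>0. \<exists>s t. a \<le> s \<and> s < t \<and> t \<le> b \<and> x \<in> {s, t} \<and> t - s < d
    \<and> \<epsilon> * (t - s) \<le> \<bar>f s t - (t - s) * h x\<bar>}" (is "negligible ?Bad")
  unfolding negligible_outer_le
proof (intro allI impI)
  fix m :: real assume "m > 0"
  define \<eta> where "\<eta> = \<epsilon> * m / 2"
  have \<eta>: "\<eta> > 0" using \<open>m > 0\<close> \<open>\<epsilon> > 0\<close> by (simp add: \<eta>_def)
  define e where "e s t = integral {s..t} h - f s t" for s t
  have super: "superadditive_on a b e"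
    unfolding e_def using superadditive_defect[OF h le] by simp
  obtain M p where p: "(M, p) \<in> partitions a b" "integral {a..b} h - \<eta> \<le> partition_sum f M p"
    using approx[OF \<eta>] by blast
  have sum_e: "partition_sum e M p \<le> \<eta>"
    using partition_sum_defect[OF h p(1) order_refl, of f] p(2) unfolding e_def by simp
  obtain \<gamma> where \<gamma>: "gauge \<gamma>" "\<And>P. \<lbrakk>P tagged_partial_division_of cbox a b; \<gamma> fine P\<rbrakk> \<Longrightarrow>
      (\<Sum>(x, k)\<in>P. norm (measure lborel k *\<^sub>R h x - integral k h)) < \<eta>"
    using Henstock_lemma[of h a b \<eta>] h \<eta> by auto
  define D where "D = p ` {..M}"
  \<comment> \<open>Avoiding \<open>D\<close> costs nothing, since \<open>D\<close> is finite, and confines each interval to one cell.\<close>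
  define K where "K = {(x, s, t). a \<le> s \<and> s < t \<and> t \<le> b \<and> x \<in> {s, t} \<and> {s..t} \<inter> D = {}
    \<and> {s..t} \<subseteq> \<gamma> x \<and> \<epsilon> * (t - s) \<le> \<bar>f s t - (t - s) * h x\<bar>}"
  have "finite D" by (simp add: D_def)
  obtain T where T: "?Bad - D \<subseteq> T" "T \<in> lmeasurable" "measure lebesgue T \<le> m"
  proof (rule vitali_intervals)
    show "s < t \<and> s \<le> x \<and> x \<le> t" if "(x, s, t) \<in> K" for x s t
      using that by (auto simp: K_def)
    show "\<exists>s t. (x, s, t) \<in> K \<and> t - s < d" if x: "x \<in> ?Bad - D" and "0 < d" for x d
    proof -
      have "open (\<gamma> x - D)" "x \<in> \<gamma> x - D"
        using \<gamma>(1) x \<open>finite D\<close> by (auto simp: gauge_def intro!: open_Diff finite_imp_closed)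
      then obtain \<delta> where \<delta>: "\<delta> > 0" "ball x \<delta> \<subseteq> \<gamma> x - D"
        unfolding open_contains_ball by blast
      have "min d \<delta> > 0" using \<open>0 < d\<close> \<delta> by simp
      then obtain s t where st: "a \<le> s" "s < t" "t \<le> b" "x \<in> {s, t}" "t - s < min d \<delta>"
          "\<epsilon> * (t - s) \<le> \<bar>f s t - (t - s) * h x\<bar>"
        using x by blast
      have "{s..t} \<subseteq> ball x \<delta>" using st by (auto simp: dist_real_def)
      then have "(x, s, t) \<in> K" using st \<delta> unfolding K_def by blast
      then show ?thesis using st by auto
    qed
  next
    fix C assume C: "C \<subseteq> K" "finite C"
      "pairwise (\<lambda>(x, s, t) (x', s', t'). disjnt {s..t} {s'..t'}) C"
    let ?l = "\<lambda>(x::real, s::real, t::real). s" and ?r = "\<lambda>(x::real, s::real, t::real). t"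
      and ?x = "\<lambda>(x::real, s::real, t::real). x"
    have CK: "a \<le> s" "s < t" "t \<le> b" "x \<in> {s, t}" "{s..t} \<inter> D = {}" "{s..t} \<subseteq> \<gamma> x"
        "\<epsilon> * (t - s) \<le> \<bar>f s t - (t - s) * h x\<bar>" if "(x, s, t) \<in> C" for x s t
      using that C(1) unfolding K_def by auto
    have pw: "pairwise (\<lambda>i j. disjnt {?l i..?r i} {?l j..?r j}) C"
      using C(3) by (simp add: case_prod_unfold)
    have "(\<Sum>i\<in>C. e (?l i) (?r i)) \<le> partition_sum e M p"
    proof (rule superadditive_sum_disjoint_partition[OF p(1) super C(2) _ _ pw])
      show "a \<le> ?l i \<and> ?l i < ?r i \<and> ?r i \<le> b" if "i \<in> C" for i
        using CK[of "fst i" "fst (snd i)" "snd (snd i)"] that by (simp add: case_prod_unfold)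
      show "p j \<notin> {?l i..?r i}" if "i \<in> C" "j \<le> M" for i j
        using CK(5)[of "fst i" "fst (snd i)" "snd (snd i)"] that
        by (auto simp: case_prod_unfold D_def)
    qed
    then have 1: "(\<Sum>(x, s, t)\<in>C. e s t) \<le> \<eta>"
      using sum_e by (simp add: case_prod_unfold)
    let ?\<phi> = "\<lambda>(x::real, s::real, t::real). (x, {s..t})"
    have "inj_on ?\<phi> C"
    proof (rule inj_onI)
      fix i j assume "i \<in> C" "j \<in> C" "?\<phi> i = ?\<phi> j"
      then show "i = j" using CK(2) by (cases i, cases j) fastforce
    qed
    then have "(\<Sum>(x, s, t)\<in>C. \<bar>(t - s) * h x - integral {s..t} h\<bar>)
        = (\<Sum>(x, k)\<in>?\<phi> ` C. norm (measure lborel k *\<^sub>R h x - integral k h))"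
      by (subst sum.reindex) (use CK(2) in \<open>force intro!: sum.cong\<close>)+
    also have "\<dots> < \<eta>"
    proof (rule \<gamma>(2))
      show "\<gamma> fine ?\<phi> ` C" using CK(6) by (fastforce simp: fine_def)
      show "?\<phi> ` C tagged_partial_division_of cbox a b"
        unfolding tagged_partial_division_of_def
      proof (intro conjI allI impI)
        show "finite (?\<phi> ` C)" using C(2) by simp
        fix x k assume "(x, k) \<in> ?\<phi> ` C"
        then obtain s t where "(x, s, t) \<in> C" "k = {s..t}" by auto
        with CK[of x s t] show "x \<in> k" "k \<subseteq> cbox a b" "\<exists>a b. k = cbox a b"
          by (auto simp flip: box_real)
      next
        fix x k x' k'
        assume *: "(x, k) \<in> ?\<phi> ` C \<and> (x', k') \<in> ?\<phi> ` C \<and> (x, k) \<noteq> (x', k')"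
        then obtain s t s' t' where st: "(x, s, t) \<in> C" "k = {s..t}" "(x', s', t') \<in> C" "k' = {s'..t'}"
          by auto
        with * have "k \<inter> k' = {}" using pairwiseD[OF C(3) st(1,3)] by (auto simp: disjnt_def)
        then show "interior k \<inter> interior k' = {}" using interior_subset by blast
      qed
    qed
    finally have 2: "(\<Sum>(x, s, t)\<in>C. \<bar>(t - s) * h x - integral {s..t} h\<bar>) < \<eta>" .
    have "\<epsilon> * (\<Sum>(x, s, t)\<in>C. t - s) = (\<Sum>(x, s, t)\<in>C. \<epsilon> * (t - s))"
      by (simp add: sum_distrib_left case_prod_unfold)
    also have "\<dots> \<le> (\<Sum>(x, s, t)\<in>C. e s t + \<bar>(t - s) * h x - integral {s..t} h\<bar>)"
    proof (rule sum_mono, clarify)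
      fix x s t assume "(x, s, t) \<in> C"
      note CK[OF this]
      moreover have "0 \<le> e s t"
        using super CK[OF \<open>(x, s, t) \<in> C\<close>] unfolding superadditive_on_def by auto
      ultimately show "\<epsilon> * (t - s) \<le> e s t + \<bar>(t - s) * h x - integral {s..t} h\<bar>"
        unfolding e_def by linarith
    qed
    also have "\<dots> \<le> \<epsilon> * m"
      using 1 2 by (simp add: case_prod_unfold sum.distrib \<eta>_def)
    finally show "(\<Sum>(x, s, t)\<in>C. t - s) \<le> m" using \<open>\<epsilon> > 0\<close> by simp
  qed blast
  have D: "D \<in> lmeasurable" "measure lebesgue D = 0"
    using \<open>finite D\<close> negligible_finite[of D] by (auto simp: negligible_imp_measurable negligible_imp_measure0)
  have "measure lebesgue (T \<union> D) \<le> m"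
    using measure_Un_le[of T lebesgue D] T D by auto
  then show "\<exists>T. ?Bad \<subseteq> T \<and> T \<in> lmeasurable \<and> measure lebesgue T \<le> m"
    using T D by (intro exI[of _ "T \<union> D"]) auto
qed

end

section \<open>Functions with dominated increments\<close>

lemma emeasure_density_lebesgue_Ioc:
  fixes g :: "real \<Rightarrow> real"
  assumes g: "integrable lebesgue g" "\<And>x. 0 \<le> g x"
  shows "emeasure (density lebesgue g) {x<..y} = ennreal (integral {x..y} g)"
proof -
  have si: "set_integrable lebesgue {x<..y} g"
    using g(1) unfolding set_integrable_def by (intro integrable_mult_indicator) auto
  have "emeasure (density lebesgue g) {x<..y} = (\<integral>\<^sup>+r. ennreal (g r) * indicator {x<..y} r \<partial>lebesgue)"
    using g by (intro emeasure_density) auto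
  also have "\<dots> = (\<integral>\<^sup>+r. ennreal (indicator {x<..y} r *\<^sub>R g r) \<partial>lebesgue)"
    by (intro nn_integral_cong) (auto simp: indicator_def)
  also have "\<dots> = ennreal (LINT r:{x<..y}|lebesgue. g r)"
    unfolding set_lebesgue_integral_def using si g unfolding set_integrable_def
    by (intro nn_integral_eq_integral) auto
  also have "(LINT r:{x<..y}|lebesgue. g r) = integral {x<..y} g"
    using si by (rule set_lebesgue_integral_eq_integral)
  also have "\<dots> = integral {x..y} g"
    by (rule integral_spike_set) (auto intro: negligible_subset[of "{x}"])
  finally show ?thesis .
qed

text \<open>The Stieltjes measure \<open>M\<close> of \<open>F\<close> is dominated by the measure \<open>N\<close> with density
  \<open>g\<close>, hence absolutely continuous, and \<open>h\<close> is its Radon-Nikodym density. Domination on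
  intervals passes to Borel sets by making the difference a measure: \<open>D\<close> is the Stieltjes
  measure of \<open>G - F\<close>, where \<open>G\<close> is a primitive of \<open>g\<close>, and \<open>N = M + D\<close> extends from
  half-open intervals to all Borel sets by a Dynkin argument.\<close>

lemma density_of_dominated_increments:
  fixes F g :: "real \<Rightarrow> real"
  assumes g: "integrable lebesgue g" "\<And>x. 0 \<le> g x"
    and mono: "\<And>x y. x \<le> y \<Longrightarrow> F x \<le> F y"
    and dom: "\<And>x y. x \<le> y \<Longrightarrow> F y - F x \<le> integral {x..y} g"
  obtains h where "\<And>x. 0 \<le> h x" "integrable lebesgue h"
    "\<And>x y. x \<le> y \<Longrightarrow> integral {x..y} h = F y - F x"
proof -
  have gU: "g integrable_on UNIV"
    using has_integral_integral_lebesgue[OF g(1)] by (auto simp: integrable_on_def)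
  have gi: "g integrable_on {x..y}" for x y
    by (rule integrable_on_subinterval[OF gU]) auto
  define G where "G x = (if 0 \<le> x then integral {0..x} g else - integral {x..0} g)" for x
  have G: "G y - G x = integral {x..y} g" if "x \<le> y" for x y
    using that Henstock_Kurzweil_Integration.integral_combine[of x 0 y g]
      Henstock_Kurzweil_Integration.integral_combine[of 0 x y g]
      Henstock_Kurzweil_Integration.integral_combine[of x y 0 g] gi
    by (auto simp: G_def not_le)
  have G_cont: "continuous (at_right x) G" for x
  proof -
    have "continuous_on {x..x+1} (\<lambda>y. G x + integral {x..y} g)"
      using indefinite_integral_continuous_1[OF gi] by (intro continuous_intros)
    then have "continuous_on {x..x+1} G"
      by (rule continuous_on_eq) (simp add: G[symmetric])
    then have "continuous (at x within {x..x+1}) G"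
      by (simp add: continuous_on_eq_continuous_within)
    then show ?thesis
      by (simp add: continuous_within at_within_Icc_at_right)
  qed
  have F_cont: "continuous (at_right x) F" for x
  proof -
    have *: "((\<lambda>y. G y - G x) \<longlongrightarrow> 0) (at_right x)"
      using G_cont[of x] by (auto simp: continuous_within intro!: tendsto_eq_intros)
    have "((\<lambda>y. F y - F x) \<longlongrightarrow> 0) (at_right x)"
    proof (rule tendsto_sandwich[OF _ _ tendsto_const *])
      show "\<forall>\<^sub>F y in at_right x. 0 \<le> F y - F x" "\<forall>\<^sub>F y in at_right x. F y - F x \<le> G y - G x"
        using mono dom G by (auto simp: eventually_at_filter less_imp_le)
    qed
    then show ?thesis by (simp add: continuous_within LIM_zero_cancel)
  qed
  define M where "M = interval_measure F"
  define D where "D = interval_measure (\<lambda>x. G x - F x)"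
  define N where "N = density lebesgue g"
  have M_Ioc: "emeasure M {x<..y} = ennreal (F y - F x)" if "x \<le> y" for x y
    unfolding M_def by (rule emeasure_interval_measure_Ioc[OF that]) (use mono F_cont in auto)
  have D_Ioc: "emeasure D {x<..y} = ennreal (G y - F y - (G x - F x))" if "x \<le> y" for x y
    unfolding D_def
  proof (rule emeasure_interval_measure_Ioc[OF that])
    show "G x - F x \<le> G y - F y" if "x \<le> y" for x y using dom[OF that] G[OF that] by simp
    show "continuous (at_right x) (\<lambda>x. G x - F x)" for x
      by (intro continuous_intros G_cont F_cont)
  qed
  have N_Ioc: "emeasure N {x<..y} = emeasure M {x<..y} + emeasure D {x<..y}" for x y
  proof (cases "x \<le> y")
    case True
    then show ?thesis
      unfolding N_def emeasure_density_lebesgue_Ioc[OF g] M_Ioc[OF True] D_Ioc[OF True]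
      using dom[OF True] mono[OF True] G[OF True] by (simp flip: ennreal_plus)
  qed simp
  have [simp]: "sets M = sets borel" "sets D = sets borel" "space M = UNIV" "space D = UNIV"
    "sets N = sets lebesgue" "space N = UNIV"
    by (auto simp: M_def D_def N_def)
  have N_UNIV: "emeasure N UNIV < \<infinity>"
  proof -
    have "emeasure N UNIV = (\<integral>\<^sup>+r. ennreal (g r) \<partial>lebesgue)"
      unfolding N_def using g by (subst emeasure_density) auto
    also have "\<dots> < \<infinity>" using g by (simp add: nn_integral_eq_integral)
    finally show ?thesis .
  qed
  have UNIV_eq: "emeasure N UNIV = emeasure M UNIV + emeasure D UNIV"
  proof -
    have U: "(\<Union>n::nat. {- real n<..real n}) = UNIV"
    proof -
      have "\<exists>n. - real n < x \<and> x \<le> real n" for x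
      proof -
        obtain n where "\<bar>x\<bar> < real n" using reals_Archimedean2 by blast
        then show ?thesis by (intro exI[of _ n]) auto
      qed
      then show ?thesis by auto
    qed
    have lim: "(\<lambda>n. emeasure K {- real n<..real n}) \<longlonglongrightarrow> emeasure K UNIV"
      if "\<And>x y. {x<..y::real} \<in> sets K" for K
      unfolding U[symmetric] using that by (intro Lim_emeasure_incseq) (auto simp: incseq_def)
    have "(\<lambda>n. emeasure M {- real n<..real n} + emeasure D {- real n<..real n})
        \<longlonglongrightarrow> emeasure M UNIV + emeasure D UNIV"
      by (intro tendsto_add lim) auto
    moreover have "(\<lambda>n. emeasure N {- real n<..real n}) \<longlonglongrightarrow> emeasure N UNIV"
      by (intro lim) auto
    ultimately show ?thesis unfolding N_Ioc using LIMSEQ_unique by blast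
  qed
  have split: "emeasure N A = emeasure M A + emeasure D A" if "A \<in> sets borel" for A
  proof -
    have A: "A \<in> sigma_sets UNIV (range (\<lambda>(a, b). {a <.. b::real}))"
      using that unfolding borel_sigma_sets_Ioc by simp
    have "Int_stable (range (\<lambda>(a, b). {a <.. b::real}))"
      by (force simp: Int_stable_def intro!: image_eqI)
    moreover have "range (\<lambda>(a, b). {a <.. b::real}) \<subseteq> Pow UNIV" by simp
    ultimately show ?thesis using A
    proof (induction rule: sigma_sets_induct_disjoint)
      case (compl A)
      then have A: "A \<in> sets borel" unfolding borel_sigma_sets_Ioc by simp
      have "emeasure N A \<noteq> \<infinity>"
        using emeasure_mono[of A UNIV N] N_UNIV by (auto simp: top_unique less_top[symmetric])
      then have fin: "emeasure N A \<noteq> \<infinity>" "emeasure M A \<noteq> \<infinity>" "emeasure D A \<noteq> \<infinity>"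
        using compl.IH by (auto simp: ennreal_add_eq_top)
      have *: "emeasure K A + emeasure K (UNIV - A) = emeasure K UNIV"
        if "A \<in> sets K" "space K = UNIV" for K
        using plus_emeasure[of A K "UNIV - A"] that sets.compl_sets[of A K] by auto
      have "emeasure N A + emeasure N (UNIV - A)
          = (emeasure M A + emeasure M (UNIV - A)) + (emeasure D A + emeasure D (UNIV - A))"
        using A UNIV_eq by (simp add: *)
      also have "\<dots> = emeasure N A + (emeasure M (UNIV - A) + emeasure D (UNIV - A))"
        using compl.IH by (simp add: ac_simps)
      finally show ?case using fin by (simp add: ennreal_add_left_cancel)
    next
      case (union A)
      then have A: "A i \<in> sets borel" for i unfolding borel_sigma_sets_Ioc by auto
      have "emeasure N (\<Union>i. A i) = (\<Sum>i. emeasure N (A i))"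
        using union.hyps A by (intro suminf_emeasure[symmetric]) auto
      also have "\<dots> = (\<Sum>i. emeasure M (A i)) + (\<Sum>i. emeasure D (A i))"
        using union.IH by (simp add: suminf_add)
      also have "\<dots> = emeasure M (\<Union>i. A i) + emeasure D (\<Union>i. A i)"
        using union.hyps A by (simp add: suminf_emeasure image_subset_iff)
      finally show ?case .
    qed (use N_Ioc in auto)
  qed
  have "absolutely_continuous lborel M"
    unfolding absolutely_continuous_def
  proof
    fix A :: "real set" assume A: "A \<in> null_sets lborel"
    then have "A \<in> null_sets lebesgue" by (rule null_sets_completionI)
    then have "emeasure N A = 0"
      using absolutely_continuousI_density[of "\<lambda>x. ennreal (g x)" lebesgue] g
      unfolding N_def by (auto simp: absolutely_continuous_def)
    then show "A \<in> null_sets M" using split[of A] null_setsD2[OF A] by (auto simp: null_sets_def)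
  qed
  then obtain h0 where h0: "h0 \<in> borel_measurable lborel" "density lborel h0 = M"
    using sigma_finite_measure.Radon_Nikodym[OF sigma_finite_lborel, of M] by auto
  have "(\<integral>\<^sup>+x. h0 x \<partial>lborel) = emeasure M UNIV"
    unfolding h0(2)[symmetric] using h0(1) by (subst emeasure_density) auto
  also have "\<dots> < \<infinity>" using N_UNIV UNIV_eq by (auto simp: less_top[symmetric] ennreal_add_eq_top)
  finally have h0_fin: "(\<integral>\<^sup>+x. h0 x \<partial>lborel) \<noteq> \<infinity>" by simp
  then have ae: "AE x in lborel. h0 x \<noteq> \<infinity>" using h0(1) by (intro nn_integral_PInf_AE) auto
  define h where "h x = enn2real (h0 x)" for x
  have hm[measurable]: "h \<in> borel_measurable lborel" unfolding h_def using h0(1) by measurable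
  have ae': "AE x in lborel. ennreal (h x) = h0 x"
    using ae by eventually_elim (simp add: h_def less_top)
  have hi: "integrable lborel h"
    using h0_fin nn_integral_cong_AE[OF ae'] by (intro integrableI_nonneg) (auto simp: h_def less_top)
  show thesis
  proof (rule that)
    show "0 \<le> h x" for x by (simp add: h_def)
    show hL: "integrable lebesgue h" using hi hm by (simp add: integrable_completion)
    show "integral {x..y} h = F y - F x" if "x \<le> y" for x y
    proof -
      have hint: "h integrable_on {x..y}"
        using has_integral_integral_lebesgue[OF hL] integrable_on_subinterval[of h UNIV x y]
        by (auto simp: integrable_on_def)
      have "ennreal (F y - F x) = emeasure (density lborel h0) {x<..y}"
        using M_Ioc[OF that] h0 by simp
      also have "\<dots> = (\<integral>\<^sup>+r. ennreal (h r) * indicator {x<..y} r \<partial>lborel)"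
        using h0(1) ae' by (subst emeasure_density) (auto intro!: nn_integral_cong_AE)
      also have "\<dots> = (\<integral>\<^sup>+r. ennreal (h r) * indicator {x<..y} r \<partial>lebesgue)"
        by (subst nn_integral_completion) auto
      also have "\<dots> = emeasure (density lebesgue h) {x<..y}"
        using hL by (subst emeasure_density) auto
      also have "\<dots> = ennreal (integral {x..y} h)"
        by (rule emeasure_density_lebesgue_Ioc[OF hL]) (simp add: h_def)
      finally show ?thesis
        using mono[OF that] Henstock_Kurzweil_Integration.integral_nonneg[OF hint]
        by (simp add: h_def)
    qed
  qed
qed

section \<open>Differentiation of subadditive interval functions\<close>

definition has_interval_derivative ::
    "(real \<Rightarrow> real \<Rightarrow> real) \<Rightarrow> real \<Rightarrow> real \<Rightarrow> real \<Rightarrow> real \<Rightarrow> bool" where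
  "has_interval_derivative f a b x l \<longleftrightarrow>
    (\<forall>\<epsilon>>0. \<exists>d>0. \<forall>s t. a \<le> s \<longrightarrow> s < t \<longrightarrow> t \<le> b \<longrightarrow> x \<in> {s, t} \<longrightarrow> t - s < d
      \<longrightarrow> \<bar>f s t - (t - s) * l\<bar> < \<epsilon> * (t - s))"

lemma has_interval_derivativeI:
  assumes "\<And>\<epsilon>. \<epsilon> > 0 \<Longrightarrow> \<exists>d>0. \<forall>s t. a \<le> s \<longrightarrow> s < t \<longrightarrow> t \<le> b \<longrightarrow> x \<in> {s, t} \<longrightarrow> t - s < d
      \<longrightarrow> \<bar>f s t - (t - s) * l\<bar> < \<epsilon> * (t - s)"
  shows "has_interval_derivative f a b x l"
  using assms unfolding has_interval_derivative_def by blast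

text \<open>The variation \<open>F\<close> has increments between \<open>f\<close> and the integrals of \<open>g\<close>; the upper
  bound makes it the primitive of some \<open>h\<close>, the lower bound makes the defect of \<open>f\<close> against
  \<open>h\<close> nonnegative, and by the definition of \<open>F\<close> as a supremum the defect has arbitrarily small
  partition sums. Hence \<open>h\<close> is the derivative of \<open>f\<close> itself almost everywhere.\<close>

lemma (in subadditive_interval) has_interval_derivative_ae:
  assumes "a < b" and g: "integrable lebesgue g" "\<And>x. 0 \<le> g x"
    and le: "\<And>s t. \<lbrakk>a \<le> s; s \<le> t; t \<le> b\<rbrakk> \<Longrightarrow> f s t \<le> integral {s..t} g"
  obtains h where "integrable lebesgue h"
    "bdd_above ((\<lambda>(M, t). partition_sum f M t) ` partitions a b)"
    "variation f a b = integral {a..b} h"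
    "negligible {x. \<not> has_interval_derivative f a b x (h x)}"
proof -
  have gi: "g integrable_on {x..y}" for x y
    using has_integral_integral_lebesgue[OF g(1)] integrable_on_subinterval[of g UNIV x y]
    by (auto simp: integrable_on_def)
  define G where "G x = integral {a..x} g" for x
  have G: "G t - G s = integral {s..t} g" if "a \<le> s" "s \<le> t" for s t
    using Henstock_Kurzweil_Integration.integral_combine[OF that gi] by (simp add: G_def)
  interpret dominated_interval f a b G
    by unfold_locales (use le G in simp)
  \<comment> \<open>Clamping to \<open>[a, b]\<close> extends the variation to the whole line, where Stieltjes measures live.\<close>
  define F where "F x = variation f a (max a (min b x))" for x
  have F_mono: "F x \<le> F y" if "x \<le> y" for x y
  proof -
    have "f (max a (min b x)) (max a (min b y)) \<le> F y - F x"
      unfolding F_def using that \<open>a < b\<close> by (intro increment_ge_f) auto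
    moreover have "0 \<le> f (max a (min b x)) (max a (min b y))"
      using that \<open>a < b\<close> by (intro nonneg) auto
    ultimately show ?thesis by simp
  qed
  have F_dom: "F y - F x \<le> integral {x..y} g" if "x \<le> y" for x y
  proof -
    let ?x = "max a (min b x)" and ?y = "max a (min b y)"
    have "F y - F x \<le> G ?y - G ?x"
      unfolding F_def using that \<open>a < b\<close> by (intro increment_le_G) auto
    also have "\<dots> = integral {?x..?y} g" using that \<open>a < b\<close> by (intro G) auto
    also have "\<dots> \<le> integral {x..y} g"
    proof (cases "?x < ?y")
      case True
      then show ?thesis using g(2) gi by (intro integral_subset_le) auto
    next
      case False
      then have eq: "?y = ?x" using that \<open>a < b\<close> by auto
      have "integral {?x..?y} g = 0"
        unfolding eq by (metis integral_refl box_real(2))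
      also have "0 \<le> integral {x..y} g"
        by (rule Henstock_Kurzweil_Integration.integral_nonneg[OF gi g(2)])
      finally show ?thesis .
    qed
    finally show ?thesis .
  qed
  obtain h where h: "\<And>x. 0 \<le> h x" "integrable lebesgue h"
      "\<And>x y. x \<le> y \<Longrightarrow> integral {x..y} h = F y - F x"
    using density_of_dominated_increments[OF g F_mono F_dom] by blast
  have hi: "h integrable_on {a..b}"
    using has_integral_integral_lebesgue[OF h(2)] integrable_on_subinterval[of h UNIV a b]
    by (auto simp: integrable_on_def)
  have F_in: "F x = variation f a x" if "a \<le> x" "x \<le> b" for x
    using that by (simp add: F_def max_def min_def)
  have total: "integral {a..b} h = variation f a b"
    using h(3)[of a b] \<open>a < b\<close> by (simp add: F_in variation_refl)
  let ?Bad = "\<lambda>\<epsilon>. {x. \<forall>d>0. \<exists>s t. a \<le> s \<and> s < t \<and> t \<le> b \<and> x \<in> {s, t} \<and> t - s < d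
      \<and> \<epsilon> * (t - s) \<le> \<bar>f s t - (t - s) * h x\<bar>}"
  have bad: "negligible (?Bad \<epsilon>)" if "\<epsilon> > 0" for \<epsilon>
  proof (rule negligible_relative_error_ge[OF hi _ _ that])
    show "f s t \<le> integral {s..t} h" if "a \<le> s" "s \<le> t" "t \<le> b" for s t
      using increment_ge_f[OF that] h(3) that by (simp add: F_in)
    fix \<eta> :: real assume "\<eta> > 0"
    show "\<exists>M t. (M, t) \<in> partitions a b \<and> integral {a..b} h - \<eta> \<le> partition_sum f M t"
    proof (rule ccontr)
      assume "\<not> ?thesis"
      then have "variation f a b \<le> integral {a..b} h - \<eta>"
        using \<open>a < b\<close> by (intro variation_least) force+
      then show False using total \<open>\<eta> > 0\<close> by simp
    qed
  qed
  have "{x. \<exists>\<epsilon>>0. x \<in> ?Bad \<epsilon>} \<subseteq> (\<Union>n. ?Bad (inverse (real (Suc n))))"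
  proof
    fix x assume "x \<in> {x. \<exists>\<epsilon>>0. x \<in> ?Bad \<epsilon>}"
    then obtain \<epsilon> where "\<epsilon> > 0" and x: "x \<in> ?Bad \<epsilon>" by blast
    then obtain n where n: "inverse (real (Suc n)) < \<epsilon>" using reals_Archimedean by blast
    have "inverse (real (Suc n)) * (t - s) \<le> z" if "s < t" "\<epsilon> * (t - s) \<le> z" for s t z
      using mult_right_mono[OF less_imp_le[OF n], of "t - s"] that by linarith
    then have "x \<in> ?Bad (inverse (real (Suc n)))" using x by blast
    then show "x \<in> (\<Union>n. ?Bad (inverse (real (Suc n))))" by blast
  qed
  moreover have "negligible (\<Union>n. ?Bad (inverse (real (Suc n))))"
    by (intro negligible_Union_nat bad) simp
  ultimately have "negligible {x. \<exists>\<epsilon>>0. x \<in> ?Bad \<epsilon>}" by (rule negligible_subset[rotated])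
  moreover have "{x. \<not> has_interval_derivative f a b x (h x)} \<subseteq> {x. \<exists>\<epsilon>>0. x \<in> ?Bad \<epsilon>}"
  proof (intro subsetI CollectI, rule ccontr)
    fix x assume x: "x \<in> {x. \<not> has_interval_derivative f a b x (h x)}" "\<not> (\<exists>\<epsilon>>0. x \<in> ?Bad \<epsilon>)"
    have "has_interval_derivative f a b x (h x)"
    proof (rule has_interval_derivativeI)
      fix \<epsilon> :: real assume "\<epsilon> > 0"
      then have "x \<notin> ?Bad \<epsilon>" using x(2) by blast
      then show "\<exists>d>0. \<forall>s t. a \<le> s \<longrightarrow> s < t \<longrightarrow> t \<le> b \<longrightarrow> x \<in> {s, t} \<longrightarrow> t - s < d
        \<longrightarrow> \<bar>f s t - (t - s) * h x\<bar> < \<epsilon> * (t - s)"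
        unfolding mem_Collect_eq by (meson not_le)
    qed
    then show False using x(1) by simp
  qed
  ultimately have "negligible {x. \<not> has_interval_derivative f a b x (h x)}"
    by (rule negligible_subset)
  then show thesis
    using h(2) bdd_above_partition_sums total by (intro that[of h]) simp_all
qed

section \<open>Action of absolutely continuous curves\<close>

lemma has_action_density_unique:
  "has_action_density c u t l \<Longrightarrow> action_density c u t = l"
  unfolding action_density_def has_action_density_def
  by (rule the_equality) (auto intro: tendsto_unique[OF trivial_limit_at_right_real])

definition cost_along ::
    "(real \<Rightarrow> 'a \<Rightarrow> 'a \<Rightarrow> real) \<Rightarrow> (real \<Rightarrow> 'a) \<Rightarrow> real \<Rightarrow> real \<Rightarrow> real" where
  "cost_along c u s t = (if s < t then c (t - s) (u s) (u t) else 0)"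

lemma (in action_space) subadditive_interval_cost_along:
  assumes u: "u \<in> {a..b} \<rightarrow> X"
  shows "subadditive_interval (cost_along c u) a b"
proof
  fix s t assume "a \<le> s" "s \<le> t" "t \<le> b"
  then show "0 \<le> cost_along c u s t"
    using u by (auto simp: cost_along_def intro!: cost_nonneg)
next
  fix r s t assume "a \<le> r" "r \<le> s" "s \<le> t" "t \<le> b"
  moreover from this have "u r \<in> X" "u s \<in> X" "u t \<in> X" using u by auto
  ultimately show "cost_along c u r t \<le> cost_along c u r s + cost_along c u s t"
    using cost_triangle[of "s - r" "t - s" "u r" "u s" "u t"]
    by (cases "r = s"; cases "s = t") (auto simp: cost_along_def)
qed (simp add: cost_along_def)

lemma curve_action_eq_variation:
  assumes "a \<le> b" and bdd: "bdd_above ((\<lambda>(M, t). partition_sum (cost_along c u) M t) ` partitions a b)"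
  shows "curve_action c u a b = ereal (variation (cost_along c u) a b)"
proof -
  let ?S = "\<lambda>(M, t). partition_sum (cost_along c u) M t"
  have "(\<Sum>j=1..M. c (t j - t (j - 1)) (u (t (j - 1))) (u (t j))) = partition_sum (cost_along c u) M t"
    if "(M, t) \<in> partitions a b" for M t
    unfolding partition_sum_def
  proof (rule sum.cong)
    fix j assume "j \<in> {1..M}"
    then have "t (j - 1) < t j"
      using that by (auto simp: partitions_def intro: strict_mono_onD)
    then show "c (t j - t (j - 1)) (u (t (j - 1))) (u (t j)) = cost_along c u (t (j - 1)) (t j)"
      by (simp add: cost_along_def)
  qed simp
  then have "curve_action c u a b = (SUP x \<in> partitions a b. ereal (?S x))"
    unfolding curve_action_def by (intro SUP_cong) auto
  also have "\<dots> = ereal (SUP x \<in> partitions a b. ?S x)"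
  proof (rule ereal_SUP[symmetric])
    obtain p where p: "p \<in> partitions a b" using partitions_nonempty[OF assms(1)] by blast
    obtain B where B: "\<And>x. x \<in> partitions a b \<Longrightarrow> ?S x \<le> B"
      using bdd unfolding bdd_above_def by blast
    have "(SUP x \<in> partitions a b. ereal (?S x)) \<le> ereal B" using B by (intro SUP_least) auto
    moreover have "ereal (?S p) \<le> (SUP x \<in> partitions a b. ereal (?S x))" using p by (rule SUP_upper)
    ultimately show "\<bar>SUP x \<in> partitions a b. ereal (?S x)\<bar> \<noteq> \<infinity>" by auto
  qed
  also have "(SUP x \<in> partitions a b. ?S x) = variation (cost_along c u) a b"
    unfolding variation_def ..
  finally show ?thesis .
qed

text \<open>An interval derivative tests all short intervals having \<open>x\<close> as an endpoint; those starting and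
  those ending at \<open>x\<close> give the two one-sided limits.\<close>

lemma has_interval_derivative_imp_has_action_density:
  assumes "a < x" "x < b"
    and deriv: "has_interval_derivative (cost_along c u) a b x l"
  shows "has_action_density c u x l"
proof -
  have quot: "dist (c (t - s) (u s) (u t) / (t - s)) l < \<epsilon>"
    if "s < t" "\<bar>cost_along c u s t - (t - s) * l\<bar> < \<epsilon> * (t - s)" for s t \<epsilon>
  proof -
    have "dist (c (t - s) (u s) (u t) / (t - s)) l = \<bar>(c (t - s) (u s) (u t) - (t - s) * l) / (t - s)\<bar>"
      using that by (simp add: dist_real_def diff_divide_distrib)
    also have "\<dots> = \<bar>cost_along c u s t - (t - s) * l\<bar> / (t - s)"
      using that by (simp add: cost_along_def)
    also have "\<dots> < \<epsilon>" using that by (simp add: divide_less_eq)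
    finally show ?thesis .
  qed
  show ?thesis
    unfolding has_action_density_def
  proof (intro conjI tendstoI)
    fix \<epsilon> :: real assume "\<epsilon> > 0"
    then obtain d where d: "d > 0"
      "\<And>s t. \<lbrakk>a \<le> s; s < t; t \<le> b; x \<in> {s, t}; t - s < d\<rbrakk>
        \<Longrightarrow> \<bar>cost_along c u s t - (t - s) * l\<bar> < \<epsilon> * (t - s)"
      using deriv unfolding has_interval_derivative_def by blast
    show "\<forall>\<^sub>F \<sigma> in at_right x. dist (c (\<sigma> - x) (u x) (u \<sigma>) / (\<sigma> - x)) l < \<epsilon>"
      unfolding eventually_at_right_field
      using d assms(1,2) by (intro exI[of _ "min b (x + d)"]) (auto intro!: quot d(2))
    show "\<forall>\<^sub>F \<sigma> in at_left x. dist (c (x - \<sigma>) (u \<sigma>) (u x) / (x - \<sigma>)) l < \<epsilon>"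
      unfolding eventually_at_left_field
      using d assms(1,2) by (intro exI[of _ "max a (x - d)"]) (auto intro!: quot d(2))
  qed
qed

theorem theorem6p3:
  fixes X :: "'a set" and c :: "real \<Rightarrow> 'a \<Rightarrow> 'a \<Rightarrow> real"
    and a b :: real and u :: "real \<Rightarrow> 'a"
  assumes "action_space X c"
    and "a < b"
    and "u \<in> AC_curves X c a b"
  shows "(AE t in lebesgue. t \<in> {a<..<b} \<longrightarrow> (\<exists>l. has_action_density c u t l))
    \<and> set_integrable lebesgue {a<..<b} (action_density c u)
    \<and> curve_action c u a b < \<infinity>
    \<and> curve_action c u a b = ereal (LINT t:{a<..<b}|lebesgue. action_density c u t)"
proof -
  interpret action_space X c by fact
  obtain g0 :: "real \<Rightarrow> real" where uX: "u \<in> {a..b} \<rightarrow> X"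
    and g0: "set_integrable lebesgue {a<..<b} g0"
      "\<And>s t. \<lbrakk>a \<le> s; s < t; t \<le> b\<rbrakk> \<Longrightarrow> c (t - s) (u s) (u t) \<le> (LINT r:{s<..<t}|lebesgue. g0 r)"
    using assms(3) unfolding AC_curves_def by blast
  interpret subadditive_interval "cost_along c u" a b
    by (rule subadditive_interval_cost_along) (rule uX)
  \<comment> \<open>The bound \<open>g0\<close> may be negative somewhere, and is integrable on the interval only.\<close>
  define g where "g x = \<bar>indicator {a<..<b} x * g0 x\<bar>" for x
  have g: "integrable lebesgue g"
    using g0(1) unfolding g_def set_integrable_def by simp
  have g_nonneg: "0 \<le> g x" for x by (simp add: g_def)
  have le: "cost_along c u s t \<le> integral {s..t} g" if st: "a \<le> s" "s \<le> t" "t \<le> b" for s t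
  proof (cases "s = t")
    case False
    have sub: "{s<..<t} \<subseteq> {a<..<b}" using st by auto
    have gst: "set_integrable lebesgue {s<..<t} g" "set_integrable lebesgue {s<..<t} g0"
      using integrable_mult_indicator[OF _ g, of "{s<..<t}"] set_integrable_subset[OF g0(1) _ sub]
      by (auto simp: set_integrable_def)
    have "cost_along c u s t \<le> (LINT r:{s<..<t}|lebesgue. g0 r)"
      using g0(2) st False by (simp add: cost_along_def)
    also have "\<dots> \<le> (LINT r:{s<..<t}|lebesgue. g r)"
      by (rule set_integral_mono[OF gst(2,1)]) (use sub in \<open>auto simp: g_def\<close>)
    also have "\<dots> = integral {s<..<t} g" using gst(1) by (rule set_lebesgue_integral_eq_integral)
    also have "\<dots> = integral {s..t} g" using integral_open_interval_real[of s t g] by simp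
    finally show ?thesis .
  qed (simp add: cost_along_def)
  obtain h where h: "integrable lebesgue h"
    and bdd: "bdd_above ((\<lambda>(M, t). partition_sum (cost_along c u) M t) ` partitions a b)"
    and var: "variation (cost_along c u) a b = integral {a..b} h"
    and neg: "negligible {x. \<not> has_interval_derivative (cost_along c u) a b x (h x)}" (is "negligible ?Bad")
    by (rule has_interval_derivative_ae[OF \<open>a < b\<close> g g_nonneg le])
  have dens: "has_action_density c u x (h x)" if "x \<in> {a<..<b} - ?Bad" for x
    using that by (intro has_interval_derivative_imp_has_action_density[of a x b]) auto
  have "AE x in lebesgue. x \<notin> ?Bad"
    using neg unfolding negligible_iff_null_sets by (rule AE_not_in)
  then have ae: "AE x in lebesgue. x \<in> {a<..<b} \<longrightarrow> (\<exists>l. has_action_density c u x l)"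
    by eventually_elim (use dens in blast)
  have dens_eq: "action_density c u x = h x" if "x \<in> {a<..<b} - ?Bad" for x
    by (rule has_action_density_unique[OF dens[OF that]])
  have "set_integrable lebesgue {a<..<b} h"
    using h unfolding set_integrable_def by (intro integrable_mult_indicator) auto
  then have int: "set_integrable lebesgue {a<..<b} (action_density c u)"
    using neg dens_eq by (rule absolutely_integrable_spike)
  have "(LINT t:{a<..<b}|lebesgue. action_density c u t) = integral {a<..<b} (action_density c u)"
    using int by (rule set_lebesgue_integral_eq_integral)
  also have "\<dots> = integral {a<..<b} h"
    by (rule integral_spike[OF neg]) (use dens_eq in auto)
  also have "\<dots> = integral {a..b} h" using integral_open_interval_real[of a b h] by simp
  finally have "curve_action c u a b = ereal (LINT t:{a<..<b}|lebesgue. action_density c u t)"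
    using curve_action_eq_variation[OF less_imp_le[OF \<open>a < b\<close>] bdd] var by simp
  with ae int show ?thesis by simp
qed

end
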